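(* Let $n\ge 1$ and let $P(z)=c_0+c_1z+\dots+c_nz^n$, $c_k\in\mathbb{C}$, $c_n\neq 0$, be a polynomial all of whose zeros lie in the closed disc $|z|\le 1$. Then for any point $z$ on the circle $|z|=1$ with $P(z)\neq 0$, the inequality $$\Lambda(P,z)\ \ge\ \left|(\Lambda(P,z)+1)\,\frac{\overline{c_0}\,P(z)}{c_n z^n\,\overline{P(z)}}-1\right|$$ holds. Equality at the point $z=1$ is attained for a polynomial $P$ of the form $$P(z)=(z-\alpha_1)\prod_{k=2}^n(z-\alpha_k),$$ where $\alpha_k$, $k=1,\dots,n$, are arbitrary complex numbers satisfying $|\alpha_1|<1$ and $|\alpha_k|=1$, $\alpha_k\neq 1$ for $k=2,\dots,n$.
   Context: For a polynomial $P$ of degree $n$ and a point $z=e^{i\theta}$ ($\theta$ real) with $P(z)\neq 0$, define $$\Lambda(P,z)=2\,(\arg P(e^{i\theta}))'_{\theta}-n,$$ where $(\arg P(e^{i\theta}))'_\theta$ is the derivative with respect to $\theta$ of a local continuous branch of the argument of $P(e^{i\theta})$; equivalently $(\arg P(e^{i\theta}))'_\theta=\operatorname{Re}\frac{zP'(z)}{P(z)}$ at $z=e^{i\theta}$, so $\Lambda(P,z)=2\operatorname{Re}\frac{zP'(z)}{P(z)}-n$. *)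

theory Defs
  imports "HOL-Analysis.Analysis" "HOL-Computational_Algebra.Polynomial"
begin

definition local_arg_branch :: "(real \<Rightarrow> complex) \<Rightarrow> real \<Rightarrow> (real \<Rightarrow> real) \<Rightarrow> bool" where
  "local_arg_branch f \<theta> g \<longleftrightarrow>
     (\<exists>U. open U \<and> \<theta> \<in> U \<and> continuous_on U g \<and> (\<forall>t\<in>U. is_Arg (f t) (g t)))"

definition arg_deriv :: "complex poly \<Rightarrow> real \<Rightarrow> real" where
  "arg_deriv P \<theta> =
     (THE d. \<exists>g. local_arg_branch (\<lambda>t. poly P (cis t)) \<theta> g \<and> (g has_real_derivative d) (at \<theta>))"

text \<open>
  The angle \<^term>\<open>Arg z\<close> is just one possible choice of \<open>\<theta>\<close> with \<open>z = cis \<theta>\<close>; by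
  \<open>Lambda_cis\<close> below any other choice gives the same value. The definition is meaningful
  for \<open>norm z = 1\<close> and \<open>poly P z \<noteq> 0\<close>.
\<close>

definition Lambda :: "complex poly \<Rightarrow> complex \<Rightarrow> real" where
  "Lambda P z = 2 * arg_deriv P (Arg z) - real (degree P)"

lemma local_arg_branch_deriv_unique:
  assumes "poly P (cis \<theta>) \<noteq> 0"
    and "local_arg_branch (\<lambda>t. poly P (cis t)) \<theta> g"
    and g: "(g has_real_derivative d) (at \<theta>)"
  shows "d = Re (cis \<theta> * poly (pderiv P) (cis \<theta>) / poly P (cis \<theta>))"
proof -
  define f where "f = (\<lambda>t. poly P (cis t))"
  define f' where "f' = \<i> * cis \<theta> * poly (pderiv P) (cis \<theta>)"
  from assms(2) obtain U where U: "open U" "\<theta> \<in> U" "\<And>t. t \<in> U \<Longrightarrow> is_Arg (f t) (g t)"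
    by (auto simp: local_arg_branch_def f_def)
  have c: "((\<lambda>t. cis t) has_vector_derivative \<i> * cis \<theta>) (at \<theta>)"
    unfolding has_vector_derivative_def
    by (rule has_derivative_eq_rhs[OF has_derivative_cis[OF has_derivative_ident]])
       (auto simp: fun_eq_iff scaleR_conv_of_real algebra_simps)
  have f: "(f has_vector_derivative f') (at \<theta>)"
    unfolding f_def f'_def
    using field_vector_diff_chain_at[OF c poly_DERIV] by (simp add: o_def mult_ac)
  have gv: "(g has_derivative (\<lambda>h. h * d)) (at \<theta>)"
    using g unfolding has_field_derivative_def by (rule has_derivative_eq_rhs) (simp add: fun_eq_iff)
  have e: "((\<lambda>t. cis (- g t)) has_vector_derivative - (of_real d * \<i> * cis (- g \<theta>))) (at \<theta>)"
    unfolding has_vector_derivative_def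
    by (rule has_derivative_eq_rhs[OF has_derivative_cis[OF has_derivative_minus[OF gv]]])
       (auto simp: fun_eq_iff scaleR_conv_of_real algebra_simps)
  have real: "f t * cis (- g t) = of_real (norm (f t))" if "t \<in> U" for t
  proof -
    have "f t = of_real (norm (f t)) * cis (g t)"
      using U(3)[OF that] by (simp add: is_Arg_def cis_conv_exp)
    then have "f t * cis (- g t) = of_real (norm (f t)) * (cis (g t) * cis (- g t))"
      by (metis mult.assoc)
    then show ?thesis by (simp add: cis_mult)
  qed
  have D: "((\<lambda>t. Im (f t * cis (- g t))) has_vector_derivative
      Im (f \<theta> * - (of_real d * \<i> * cis (- g \<theta>)) + f' * cis (- g \<theta>))) (at \<theta>)"
    using has_vector_derivative_mult[OF f e]
    by (intro bounded_linear.has_vector_derivative[OF bounded_linear_Im])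
  moreover have "((\<lambda>t. Im (f t * cis (- g t))) has_vector_derivative 0) (at \<theta>)"
    by (rule has_vector_derivative_transform_within_open[OF has_vector_derivative_const[of 0] U(1,2)])
       (simp add: real)
  ultimately have "Im (f \<theta> * - (of_real d * \<i> * cis (- g \<theta>)) + f' * cis (- g \<theta>)) = 0"
    by (rule vector_derivative_unique_at)
  moreover have "f \<theta> * - (of_real d * \<i> * cis (- g \<theta>)) = - (\<i> * of_real d * (f \<theta> * cis (- g \<theta>)))"
    by (simp add: mult_ac)
  ultimately have "Im (- (\<i> * of_real d * of_real (norm (f \<theta>))) + f' * cis (- g \<theta>)) = 0"
    by (simp only: real[OF U(2)])
  then have eq: "d * norm (f \<theta>) = Im (f' * cis (- g \<theta>))"
    by simp
  have nz: "f \<theta> \<noteq> 0" using assms(1) by (simp add: f_def)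
  have "f' / f \<theta> = (f' * cis (- g \<theta>)) / (f \<theta> * cis (- g \<theta>))"
    by simp
  also have "\<dots> = (f' * cis (- g \<theta>)) / of_real (norm (f \<theta>))"
    by (simp only: real[OF U(2)])
  finally have "Im (f' / f \<theta>) = Im (f' * cis (- g \<theta>)) / norm (f \<theta>)"
    by (simp only: Im_divide_of_real)
  then have "Im (f' / f \<theta>) = d"
    using nz by (simp add: eq[symmetric] del: times_complex.sel)
  moreover have "f' / f \<theta> = \<i> * (cis \<theta> * poly (pderiv P) (cis \<theta>) / poly P (cis \<theta>))"
    by (simp add: f'_def f_def)
  ultimately show ?thesis by (metis Im_i_times)
qed

lemma local_arg_branch_deriv_exists:
  assumes "poly P (cis \<theta>) \<noteq> 0"
  shows "\<exists>g d. local_arg_branch (\<lambda>t. poly P (cis t)) \<theta> g \<and> (g has_real_derivative d) (at \<theta>)"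
proof -
  define f where "f = (\<lambda>t. poly P (cis t))"
  define q where "q = (\<lambda>t. f t / f \<theta>)"
  define g where "g = (\<lambda>t. Arg (f \<theta>) + Im (Ln (q t)))"
  define U where "U = {t. q t \<in> {w. Re w > 0}}"
  have nz: "f \<theta> \<noteq> 0" using assms by (simp add: f_def)
  have cq: "continuous_on UNIV q"
    unfolding q_def f_def using nz by (intro continuous_intros) (auto simp: f_def)
  have "open U"
    unfolding U_def using cq open_halfspace_Re_gt[of 0]
    by (metis continuous_on_open_vimage open_UNIV vimage_def Int_UNIV_right)
  have "\<theta> \<in> U" using nz by (simp add: U_def q_def)
  have slit: "q t \<notin> \<real>\<^sub>\<le>\<^sub>0" "q t \<noteq> 0" if "t \<in> U" for t
    using that by (auto simp: U_def complex_nonpos_Reals_iff)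
  have "continuous_on U g"
    unfolding g_def using slit continuous_on_subset[OF cq]
    by (intro continuous_intros) auto
  moreover have "is_Arg (f t) (g t)" if "t \<in> U" for t
  proof -
    have "f t = f \<theta> * q t" using nz by (simp add: q_def)
    moreover have "is_Arg (f \<theta>) (Arg (f \<theta>))" using nz by (rule is_Arg_Arg)
    moreover have "is_Arg (q t) (Im (Ln (q t)))"
      using slit[OF that] is_Arg_Arg Arg_eq_Im_Ln by metis
    ultimately show ?thesis
      by (simp add: g_def is_Arg_def exp_add norm_mult distrib_left)
         (metis (no_types, opaque_lifting) mult.assoc mult.left_commute)
  qed
  ultimately have br: "local_arg_branch (\<lambda>t. poly P (cis t)) \<theta> g"
    using \<open>open U\<close> \<open>\<theta> \<in> U\<close> by (auto simp: local_arg_branch_def f_def)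
  have c: "((\<lambda>t. cis t) has_vector_derivative \<i> * cis \<theta>) (at \<theta>)"
    unfolding has_vector_derivative_def
    by (rule has_derivative_eq_rhs[OF has_derivative_cis[OF has_derivative_ident]])
       (auto simp: fun_eq_iff scaleR_conv_of_real algebra_simps)
  have "((\<lambda>t. f t * inverse (f \<theta>)) has_vector_derivative
          \<i> * cis \<theta> * poly (pderiv P) (cis \<theta>) * inverse (f \<theta>)) (at \<theta>)"
    using has_vector_derivative_mult_left[OF field_vector_diff_chain_at[OF c poly_DERIV]]
    by (simp add: o_def f_def)
  then obtain q' where q': "(q has_vector_derivative q') (at \<theta>)"
    unfolding q_def divide_inverse by blast
  have "((\<lambda>t. Ln (q t)) has_vector_derivative (q' * inverse (q \<theta>))) (at \<theta>)"
    using field_vector_diff_chain_at[OF q' has_field_derivative_Ln[OF slit(1)[OF \<open>\<theta> \<in> U\<close>]]]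
    by (simp add: o_def)
  then have "((\<lambda>t. Im (Ln (q t))) has_vector_derivative Im (q' * inverse (q \<theta>))) (at \<theta>)"
    by (rule bounded_linear.has_vector_derivative[OF bounded_linear_Im])
  then have "((\<lambda>t. Im (Ln (q t))) has_real_derivative Im (q' * inverse (q \<theta>))) (at \<theta>)"
    by (simp add: has_real_derivative_iff_has_vector_derivative)
  then have "(g has_real_derivative 0 + Im (q' * inverse (q \<theta>))) (at \<theta>)"
    unfolding g_def by (intro DERIV_add DERIV_const)
  with br show ?thesis by blast
qed

lemma arg_deriv_eq:
  assumes "poly P (cis \<theta>) \<noteq> 0"
  shows "arg_deriv P \<theta> = Re (cis \<theta> * poly (pderiv P) (cis \<theta>) / poly P (cis \<theta>))"
  unfolding arg_deriv_def
proof (rule the_equality)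
  show "\<exists>g. local_arg_branch (\<lambda>t. poly P (cis t)) \<theta> g \<and>
      (g has_real_derivative Re (cis \<theta> * poly (pderiv P) (cis \<theta>) / poly P (cis \<theta>))) (at \<theta>)"
    using local_arg_branch_deriv_exists[OF assms] local_arg_branch_deriv_unique[OF assms] by metis
qed (use local_arg_branch_deriv_unique[OF assms] in blast)

lemma Lambda_eq:
  assumes "norm z = 1" "poly P z \<noteq> 0"
  shows "Lambda P z = 2 * Re (z * poly (pderiv P) z / poly P z) - real (degree P)"
proof -
  have "cis (Arg z) = z"
    using assms(1) by (metis cis_Arg norm_zero zero_neq_one sgn_div_norm inverse_1 scaleR_one)
  with assms(2) arg_deriv_eq[of P "Arg z"] show ?thesis by (simp add: Lambda_def)
qed

lemma Lambda_cis:
  assumes "poly P (cis \<theta>) \<noteq> 0"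
  shows "Lambda P (cis \<theta>) = 2 * arg_deriv P \<theta> - real (degree P)"
  using assms by (simp add: Lambda_eq arg_deriv_eq)

end

theory Submission
  imports Defs "HOL-Computational_Algebra.Fundamental_Theorem_Algebra"
begin

text \<open>
  Write \<open>q(P)\<close> for the factor \<open>cnj c\<^sub>0 P(z) / (c\<^sub>n z\<^sup>n cnj (P(z)))\<close> and \<open>p(P)\<close> for
  \<open>\<Lambda>(P,z)\<close>. At a fixed point \<open>z\<close> of the unit circle \<open>p\<close> turns products of polynomials
  into sums and \<open>q\<close> turns them into products (\<open>Lambda_prod\<close>, \<open>reversal_ratio_prod\<close>), and a
  nonzero constant polynomial has \<open>p = 0\<close>, \<open>q = 1\<close>. So everything is governed by the linear factors
  \<open>z - a\<close>, for which \<open>p = (1 - \<bar>a\<bar>\<^sup>2) / \<bar>z - a\<bar>\<^sup>2\<close> is the Poisson kernel and a direct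
  computation yields the equality \<open>\<bar>(1 + p) q - 1\<bar> = \<bar>p\<bar>\<close> (\<open>norm_linear_factor\<close>).

  What makes the inequality survive multiplication is geometry: \<open>\<bar>(1 + p) q - 1\<bar> \<le> p\<close> says
  that \<open>q\<close> lies in the disc with centre \<open>1 / (1 + p)\<close> and radius \<open>p / (1 + p)\<close>, which is internally
  tangent to the unit disc at \<open>1\<close>. Such a horodisc is equally described by
  \<open>\<bar>1 - q\<bar>\<^sup>2 \<le> p (1 - \<bar>q\<bar>\<^sup>2)\<close> (\<open>horodisc_iff_norm\<close>), and in this form the Cauchy-Schwarz
  inequality shows that a product of points of the horodiscs with parameters \<open>p\<close> and \<open>p'\<close>
  lies in the horodisc with parameter \<open>p + p'\<close> (\<open>horodisc_mult\<close>).

  If all zeros but one are unimodular, their factors have \<open>p = 0\<close>. The horodisc with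
  parameter \<open>0\<close> is the single point \<open>1\<close>, so these factors change neither \<open>p\<close> nor \<open>q\<close>, and the
  equality for the remaining linear factor is an equality for the whole polynomial.
\<close>

section \<open>Horodiscs at the point 1\<close>

text \<open>
  For \<open>p \<ge> 0\<close> this is the closed disc of radius \<open>p / (1 + p)\<close> inside the closed unit disc that touches
  the unit circle at \<open>1\<close>. The level sets of \<open>\<bar>1 - q\<bar>\<^sup>2 / (1 - \<bar>q\<bar>\<^sup>2)\<close> are the horocycles at \<open>1\<close>;
  clearing the denominator keeps the tangency point \<open>q = 1\<close> in the set.
\<close>

definition horodisc :: "real \<Rightarrow> complex set" where
  "horodisc p = {q. (norm (1 - q))\<^sup>2 \<le> p * (1 - (norm q)\<^sup>2)}"

text \<open>
  The squares of the two sides of the norm inequality differ by \<open>1 + p\<close> times the difference of the two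
  sides of the defining inequality.
\<close>

lemma horodisc_iff_norm:
  assumes "p \<ge> 0"
  shows "q \<in> horodisc p \<longleftrightarrow> norm (of_real (p + 1) * q - 1) \<le> p"
proof -
  have "(norm (of_real (p + 1) * q - 1))\<^sup>2 - p\<^sup>2
      = (p + 1) * ((norm (1 - q))\<^sup>2 - p * (1 - (norm q)\<^sup>2))"
    unfolding cmod_power2 by (simp add: power2_eq_square algebra_simps)
  moreover have "norm (of_real (p + 1) * q - 1) \<le> p
      \<longleftrightarrow> (norm (of_real (p + 1) * q - 1))\<^sup>2 - p\<^sup>2 \<le> 0"
    using assms by (simp add: abs_le_square_iff[symmetric])
  ultimately show ?thesis
    using assms by (simp add: horodisc_def mult_le_0_iff)
qed

lemma horodisc_0_iff: "q \<in> horodisc 0 \<longleftrightarrow> q = 1"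
  by (auto simp: horodisc_def)

lemma horodisc_imp_norm_le_1:
  assumes "p \<ge> 0" "q \<in> horodisc p"
  shows "norm q \<le> 1"
proof (rule ccontr)
  assume neg: "\<not> norm q \<le> 1"
  then have "1 - (norm q)\<^sup>2 \<le> 0"
    by (simp add: one_le_power)
  with assms(1) have "p * (1 - (norm q)\<^sup>2) \<le> 0"
    by (rule mult_nonneg_nonpos)
  with assms(2) have "(norm (1 - q))\<^sup>2 \<le> 0"
    unfolding horodisc_def mem_Collect_eq by linarith
  then have "q = 1"
    by simp
  with neg show False
    by simp
qed

lemma horodisc_mult:
  assumes "p \<ge> 0" "p' \<ge> 0" "q \<in> horodisc p" "q' \<in> horodisc p'"
  shows "q * q' \<in> horodisc (p + p')"
proof -
  define x where "x = norm (1 - q)"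
  define y where "y = norm q * norm (1 - q')"
  define A where "A = 1 - (norm q)\<^sup>2"
  define B where "B = (norm q)\<^sup>2 * (1 - (norm q')\<^sup>2)"
  have x: "x\<^sup>2 \<le> p * A"
    using assms(3) by (simp add: horodisc_def x_def A_def)
  have "(norm q)\<^sup>2 * (norm (1 - q'))\<^sup>2 \<le> (norm q)\<^sup>2 * (p' * (1 - (norm q')\<^sup>2))"
    using assms(4) by (intro mult_left_mono) (simp_all add: horodisc_def)
  then have y: "y\<^sup>2 \<le> p' * B"
    by (simp add: y_def B_def power_mult_distrib mult_ac)
  have "1 - q * q' = (1 - q) + q * (1 - q')"
    by (simp add: algebra_simps)
  then have tri: "norm (1 - q * q') \<le> x + y"
    by (metis norm_triangle_ineq norm_mult x_def y_def)
  \<comment> \<open>Cauchy-Schwarz for \<open>(\<surd>p, \<surd>p')\<close> and \<open>(\<surd>A, \<surd>B)\<close>, with \<open>A + B = 1 - \<bar>q q'\<bar>\<^sup>2\<close>.\<close>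
  have "(x + y)\<^sup>2 \<le> (p + p') * (A + B)"
  proof -
    have "(x * y)\<^sup>2 \<le> (p * A) * (p' * B)"
      unfolding power_mult_distrib using x y
      by (intro mult_mono) (auto intro: order_trans[OF zero_le_power2])
    also have "\<dots> = (p * B) * (p' * A)"
      by simp
    also have "4 * \<dots> \<le> (p * B + p' * A)\<^sup>2"
      using zero_le_power2[of "p * B - p' * A"] by (simp add: power2_eq_square algebra_simps)
    finally have "(2 * (x * y))\<^sup>2 \<le> (p * B + p' * A)\<^sup>2"
      by (simp add: power_mult_distrib)
    moreover have "0 \<le> p * B + p' * A"
      using assms(1,2) horodisc_imp_norm_le_1[OF assms(1,3)] horodisc_imp_norm_le_1[OF assms(2,4)]
      by (simp add: A_def B_def power_le_one)
    ultimately have "2 * (x * y) \<le> p * B + p' * A"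
      by (rule power2_le_imp_le)
    with x y show ?thesis
      by (simp add: power2_sum algebra_simps)
  qed
  moreover have "A + B = 1 - (norm (q * q'))\<^sup>2"
    by (simp add: A_def B_def norm_mult power_mult_distrib algebra_simps)
  moreover have "(norm (1 - q * q'))\<^sup>2 \<le> (x + y)\<^sup>2"
    using tri by (intro power_mono) auto
  ultimately show ?thesis
    by (simp add: horodisc_def)
qed

lemma horodisc_prod:
  assumes "finite I" "\<And>i. i \<in> I \<Longrightarrow> p i \<ge> 0" "\<And>i. i \<in> I \<Longrightarrow> q i \<in> horodisc (p i)"
  shows "(\<Prod>i\<in>I. q i) \<in> horodisc (\<Sum>i\<in>I. p i)"
  using assms
  by (induction I rule: finite_induct) (simp_all add: horodisc_0_iff horodisc_mult sum_nonneg)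

section \<open>Behaviour of the two functionals under multiplication\<close>

lemma Lambda_mult:
  assumes "norm z = 1" "poly P z \<noteq> 0" "poly Q z \<noteq> 0"
  shows "Lambda (P * Q) z = Lambda P z + Lambda Q z"
proof -
  have "P \<noteq> 0" "Q \<noteq> 0"
    using assms(2,3) by auto
  then have deg: "degree (P * Q) = degree P + degree Q"
    by (rule degree_mult_eq)
  have "z * poly (pderiv (P * Q)) z / poly (P * Q) z
      = z * poly (pderiv P) z / poly P z + z * poly (pderiv Q) z / poly Q z"
    using assms(2,3) by (simp add: pderiv_mult field_simps)
  then show ?thesis
    using assms by (simp add: Lambda_eq deg)
qed

lemma Lambda_const:
  assumes "norm z = 1" "c \<noteq> 0"
  shows "Lambda [:c:] z = 0"
  using assms by (simp add: Lambda_eq)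

lemma Lambda_prod:
  assumes "finite I" "norm z = 1" "\<And>i. i \<in> I \<Longrightarrow> poly (f i) z \<noteq> 0"
  shows "Lambda (\<Prod>i\<in>I. f i) z = (\<Sum>i\<in>I. Lambda (f i) z)"
  using assms(1,3)
proof (induction I rule: finite_induct)
  case empty
  then show ?case
    using Lambda_const[OF assms(2), of 1] by (simp add: one_pCons)
next
  case (insert i I)
  then show ?case
    using assms(2) by (simp add: Lambda_mult poly_prod)
qed

text \<open>
  The reversed polynomial \<open>z\<^sup>n cnj (P(1 / cnj z))\<close> equals \<open>z\<^sup>n cnj (P(z))\<close> on the unit circle,
  and its coefficient at \<open>z\<^sup>n\<close> is \<open>cnj c\<^sub>0\<close>. For \<open>c\<^sub>0 \<noteq> 0\<close> the value at a point of the circle is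
  therefore the quotient of \<open>P\<close> by its reversed polynomial, both made monic.
\<close>

definition reversal_ratio :: "complex poly \<Rightarrow> complex \<Rightarrow> complex" where
  "reversal_ratio P z =
     cnj (coeff P 0) * poly P z / (lead_coeff P * z ^ degree P * cnj (poly P z))"

lemma reversal_ratio_mult:
  assumes "P \<noteq> 0" "Q \<noteq> 0"
  shows "reversal_ratio (P * Q) z = reversal_ratio P z * reversal_ratio Q z"
  using assms
  by (simp add: reversal_ratio_def degree_mult_eq coeff_mult_degree_sum coeff_mult_0 power_add
      mult_ac)

lemma reversal_ratio_const:
  assumes "c \<noteq> 0"
  shows "reversal_ratio [:c:] z = 1"
  using assms by (simp add: reversal_ratio_def)

lemma reversal_ratio_prod:
  assumes "finite I" "\<And>i. i \<in> I \<Longrightarrow> f i \<noteq> 0"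
  shows "reversal_ratio (\<Prod>i\<in>I. f i) z = (\<Prod>i\<in>I. reversal_ratio (f i) z)"
  using assms
proof (induction I rule: finite_induct)
  case empty
  then show ?case
    using reversal_ratio_const[of 1] by (simp add: one_pCons)
next
  case (insert i I)
  then show ?case
    by (simp add: reversal_ratio_mult)
qed

section \<open>Linear factors\<close>

lemma Lambda_linear:
  assumes "norm z = 1" "z \<noteq> a"
  shows "Lambda [:- a, 1:] z = (1 - (norm a)\<^sup>2) / (norm (z - a))\<^sup>2"
proof -
  have z: "(Re z)\<^sup>2 + (Im z)\<^sup>2 = 1"
    using assms(1) by (simp add: cmod_power2[symmetric])
  have nz: "(Re z - Re a)\<^sup>2 + (Im z - Im a)\<^sup>2 \<noteq> 0"
    using assms(2) by (simp add: sum_power2_eq_zero_iff complex_eq_iff)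
  have "Lambda [:- a, 1:] z = 2 * Re (z / (z - a)) - 1"
    using assms by (simp add: Lambda_eq pderiv_pCons)
  also have "\<dots> = (1 - (norm a)\<^sup>2) / (norm (z - a))\<^sup>2"
  proof -
    define D where "D = (Re z - Re a)\<^sup>2 + (Im z - Im a)\<^sup>2"
    define N where "N = Re z * (Re z - Re a) + Im z * (Im z - Im a)"
    have "2 * N - D = 1 - ((Re a)\<^sup>2 + (Im a)\<^sup>2)"
      using z by (simp add: D_def N_def power2_eq_square algebra_simps)
    moreover have "2 * (N / D) - 1 = (2 * N - D) / D"
      using nz by (simp add: D_def[symmetric] diff_divide_distrib)
    ultimately show ?thesis
      unfolding Re_divide cmod_power2 by (simp add: D_def N_def)
  qed
  finally show ?thesis .
qed

text \<open>
  On the circle \<open>z cnj (z - a) = 1 - cnj a z\<close>, so that \<open>q = - cnj a (z - a) / (1 - cnj a z)\<close>, while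
  \<open>1 + p = z / (z - a) + 1 / (1 - cnj a z)\<close>. Expanding, all terms in \<open>z\<close> and \<open>z\<^sup>2\<close> of the numerator of
  \<open>(1 + p) q - 1\<close> cancel and \<open>- (1 - \<bar>a\<bar>\<^sup>2) / (1 - cnj a z)\<^sup>2\<close> remains.
\<close>

lemma norm_linear_factor:
  assumes "norm z = 1" "z \<noteq> a"
  defines "p \<equiv> Lambda [:- a, 1:] z"
  shows "norm (of_real (p + 1) * reversal_ratio [:- a, 1:] z - 1) = \<bar>p\<bar>"
proof -
  define w where "w = 1 - cnj a * z"
  have zz: "z * cnj z = 1"
    using assms(1) by (simp add: complex_norm_square[symmetric])
  have w: "z * cnj (z - a) = w"
    using zz by (simp add: w_def algebra_simps)
  have za: "z - a \<noteq> 0" and z0: "z \<noteq> 0"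
    using assms(1,2) by auto
  with w have w0: "w \<noteq> 0"
    by (metis complex_cnj_zero_iff mult_eq_0_iff)
  have normw: "norm w = norm (z - a)"
    using arg_cong[OF w, of norm] assms(1) by (simp add: norm_mult del: complex_cnj_diff)
  have q: "reversal_ratio [:- a, 1:] z = - cnj a * (z - a) / w"
    using w by (simp add: reversal_ratio_def del: complex_cnj_diff)
  have aa: "of_real ((norm a)\<^sup>2) = a * cnj a"
    by (rule complex_norm_square)
  have nn: "of_real ((norm (z - a))\<^sup>2) = (z - a) * cnj (z - a)"
    by (rule complex_norm_square)
  have "of_real p = (1 - a * cnj a) / ((z - a) * cnj (z - a))"
    unfolding p_def Lambda_linear[OF assms(1,2)] of_real_divide of_real_diff aa nn by simp
  also have "\<dots> = z * (1 - a * cnj a) / ((z - a) * w)"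
    unfolding w[symmetric] using z0 za by (simp add: divide_simps)
  finally have p: "of_real p = z * (1 - a * cnj a) / ((z - a) * w)" .
  have "of_real (p + 1) * reversal_ratio [:- a, 1:] z - 1 = - (1 - a * cnj a) / w\<^sup>2"
    unfolding of_real_add p q using za w0
    by (simp add: divide_simps power2_eq_square) (simp add: w_def algebra_simps)
  also have "norm \<dots> = \<bar>1 - (norm a)\<^sup>2\<bar> / (norm w)\<^sup>2"
  proof -
    have "1 - a * cnj a = of_real (1 - (norm a)\<^sup>2)"
      by (simp only: of_real_diff aa of_real_1)
    then show ?thesis
      by (simp only: norm_divide norm_minus_cancel norm_power norm_of_real)
  qed
  also have "\<dots> = \<bar>p\<bar>"
    unfolding p_def Lambda_linear[OF assms(1,2)] normw by simp
  finally show ?thesis .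
qed

section \<open>Polynomials with all zeros in the closed unit disc\<close>

text \<open>
  The fundamental theorem of algebra reduces the claim to linear factors; their parameters are
  non-negative because the zeros lie in the closed disc.
\<close>

lemma reversal_ratio_in_horodisc:
  assumes "norm z = 1" "poly P z \<noteq> 0" "\<And>w. poly P w = 0 \<Longrightarrow> norm w \<le> 1"
  shows "Lambda P z \<ge> 0" "reversal_ratio P z \<in> horodisc (Lambda P z)"
proof -
  obtain root where root: "smult (lead_coeff P) (\<Prod>i<degree P. [:- root i, 1:]) = P"
    using complex_poly_decompose' .
  define c where "c = lead_coeff P"
  define f where "f i = [:- root i, 1:]" for i
  define I where "I = {..<degree P}"
  have P: "P = [:c:] * (\<Prod>i\<in>I. f i)"
    using root by (simp add: c_def f_def I_def)
  have c: "c \<noteq> 0"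
    using assms(2) by (auto simp: c_def)
  have zero: "poly P (root i) = 0" if "i \<in> I" for i
    using that unfolding P by (auto simp: poly_prod f_def I_def)
  have le: "norm (root i) \<le> 1" and ne: "z \<noteq> root i" if "i \<in> I" for i
    using zero[OF that] assms(2,3) by auto
  have fz: "poly (f i) z \<noteq> 0" if "i \<in> I" for i
    using ne[OF that] by (simp add: f_def)
  have prodz: "poly (\<Prod>i\<in>I. f i) z \<noteq> 0"
    using fz by (simp add: poly_prod I_def)
  have L: "Lambda P z = (\<Sum>i\<in>I. Lambda (f i) z)"
  proof -
    have "Lambda P z = Lambda [:c:] z + Lambda (\<Prod>i\<in>I. f i) z"
      unfolding P using assms(1) c prodz by (intro Lambda_mult) simp_all
    also have "\<dots> = (\<Sum>i\<in>I. Lambda (f i) z)"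
      using assms(1) c fz Lambda_prod[of I z f] by (simp add: Lambda_const I_def)
    finally show ?thesis .
  qed
  have R: "reversal_ratio P z = (\<Prod>i\<in>I. reversal_ratio (f i) z)"
  proof -
    have "(\<Prod>i\<in>I. f i) \<noteq> 0"
      using prodz by auto
    then show ?thesis
      unfolding P using c
      by (subst reversal_ratio_mult)
         (simp_all add: reversal_ratio_const reversal_ratio_prod I_def f_def)
  qed
  have nonneg: "Lambda (f i) z \<ge> 0" if "i \<in> I" for i
    using le[OF that] unfolding f_def Lambda_linear[OF assms(1) ne[OF that]]
    by (simp add: power_le_one)
  moreover have "reversal_ratio (f i) z \<in> horodisc (Lambda (f i) z)" if "i \<in> I" for i
    using nonneg[OF that] norm_linear_factor[OF assms(1) ne[OF that]]
    unfolding horodisc_iff_norm[OF nonneg[OF that]] by (simp add: f_def)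
  ultimately show "Lambda P z \<ge> 0" "reversal_ratio P z \<in> horodisc (Lambda P z)"
    unfolding L R by (auto simp: I_def intro: sum_nonneg horodisc_prod)
qed

text \<open>
  A unimodular zero contributes \<open>0\<close> to \<open>\<Lambda>\<close>, so the horodisc containing the ratio shrinks to its
  tangency point.
\<close>

lemma unimodular_zeros:
  assumes "norm z = 1" "finite I" "\<And>i. i \<in> I \<Longrightarrow> norm (\<alpha> i) = 1 \<and> \<alpha> i \<noteq> z"
  defines "Q \<equiv> \<Prod>i\<in>I. [:- \<alpha> i, 1:]"
  shows "poly Q z \<noteq> 0" "Lambda Q z = 0" "reversal_ratio Q z = 1"
proof -
  show Qz: "poly Q z \<noteq> 0"
    using assms(2,3) by (auto simp: Q_def poly_prod)
  have "Lambda Q z = (\<Sum>i\<in>I. Lambda [:- \<alpha> i, 1:] z)"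
    unfolding Q_def using assms(1-3) by (intro Lambda_prod) auto
  also have "\<dots> = 0"
  proof (intro sum.neutral ballI)
    fix i assume "i \<in> I"
    with assms(3) have "norm (\<alpha> i) = 1" "z \<noteq> \<alpha> i"
      by auto
    then show "Lambda [:- \<alpha> i, 1:] z = 0"
      using Lambda_linear[OF assms(1)] by simp
  qed
  finally show L: "Lambda Q z = 0" .
  have "norm w \<le> 1" if "poly Q w = 0" for w
    using that assms(2,3) by (auto simp: Q_def poly_prod)
  from reversal_ratio_in_horodisc(2)[OF assms(1) Qz this] show "reversal_ratio Q z = 1"
    by (simp add: L horodisc_0_iff)
qed

theorem theorem1:
  fixes n :: nat
  assumes "n \<ge> 1"
  shows "(\<forall>P :: complex poly. degree P = n \<longrightarrow> (\<forall>w. poly P w = 0 \<longrightarrow> norm w \<le> 1) \<longrightarrow>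
            (\<forall>z. norm z = 1 \<longrightarrow> poly P z \<noteq> 0 \<longrightarrow>
               Lambda P z \<ge>
                 norm (of_real (Lambda P z + 1) *
                   (cnj (coeff P 0) * poly P z / (coeff P n * z ^ n * cnj (poly P z))) - 1)))
       \<and> (\<forall>(P :: complex poly) (\<alpha> :: nat \<Rightarrow> complex).
            norm (\<alpha> 1) < 1 \<longrightarrow> (\<forall>k\<in>{2..n}. norm (\<alpha> k) = 1 \<and> \<alpha> k \<noteq> 1) \<longrightarrow>
            P = [:- \<alpha> 1, 1:] * (\<Prod>k=2..n. [:- \<alpha> k, 1:]) \<longrightarrow>
               Lambda P 1 =
                 norm (of_real (Lambda P 1 + 1) *
                   (cnj (coeff P 0) * poly P 1 / (coeff P n * 1 ^ n * cnj (poly P 1))) - 1))"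
proof (intro conjI allI impI)
  fix P :: "complex poly" and z :: complex
  assume P: "degree P = n" "\<forall>w. poly P w = 0 \<longrightarrow> norm w \<le> 1" and z: "norm z = 1" "poly P z \<noteq> 0"
  have "Lambda P z \<ge> 0" "reversal_ratio P z \<in> horodisc (Lambda P z)"
    using reversal_ratio_in_horodisc[OF z] P(2) by blast+
  then show "Lambda P z \<ge>
      norm (of_real (Lambda P z + 1) *
        (cnj (coeff P 0) * poly P z / (coeff P n * z ^ n * cnj (poly P z))) - 1)"
    by (simp add: horodisc_iff_norm reversal_ratio_def P(1))
next
  fix P :: "complex poly" and \<alpha> :: "nat \<Rightarrow> complex"
  assume \<alpha>1: "norm (\<alpha> 1) < 1" and \<alpha>: "\<forall>k\<in>{2..n}. norm (\<alpha> k) = 1 \<and> \<alpha> k \<noteq> 1"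
    and P: "P = [:- \<alpha> 1, 1:] * (\<Prod>k=2..n. [:- \<alpha> k, 1:])"
  define Q where "Q = (\<Prod>k=2..n. [:- \<alpha> k, 1:])"
  have Q: "poly Q 1 \<noteq> 0" "Lambda Q 1 = 0" "reversal_ratio Q 1 = 1"
    unfolding Q_def using \<alpha> by (intro unimodular_zeros; simp)+
  then have Q0: "Q \<noteq> 0"
    by auto
  have ne: "(1 :: complex) \<noteq> \<alpha> 1"
    using \<alpha>1 by auto
  have PQ: "P = [:- \<alpha> 1, 1:] * Q"
    by (simp only: P Q_def)
  have L: "Lambda P 1 = Lambda [:- \<alpha> 1, 1:] 1"
    unfolding PQ using Q ne by (subst Lambda_mult) simp_all
  have R: "reversal_ratio P 1 = reversal_ratio [:- \<alpha> 1, 1:] 1"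
    unfolding PQ using Q Q0 by (subst reversal_ratio_mult) simp_all
  have "Lambda P 1 \<ge> 0"
    using \<alpha>1 ne unfolding L by (subst Lambda_linear) (simp_all add: power_le_one)
  moreover have "norm (of_real (Lambda P 1 + 1) * reversal_ratio P 1 - 1) = \<bar>Lambda P 1\<bar>"
    unfolding L R using ne by (intro norm_linear_factor) simp_all
  moreover have "degree P = n"
  proof -
    have "degree Q = n - 1"
      unfolding Q_def by (subst degree_prod_eq_sum_degree) simp_all
    then show ?thesis
      unfolding PQ using Q0 assms by (subst degree_mult_eq) simp_all
  qed
  ultimately show "Lambda P 1 =
      norm (of_real (Lambda P 1 + 1) *
        (cnj (coeff P 0) * poly P 1 / (coeff P n * 1 ^ n * cnj (poly P 1))) - 1)"
    by (simp add: reversal_ratio_def)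
qed

end
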